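(* Let $n\geqslant 2$ and let $L_1,\dots,L_n$ be finite lattices, each with at least two elements, such that $|L_i|>2$ for at least two indices $i$. Let $\mathscr{P}=\mathscr{P}(L_1,\dots,L_n)$ be the associated parachute lattice, and suppose $\mathscr{P}\cong[H,G]$, where $G$ is a finite group and $H\leqslant G$ is core-free in $G$. Then: (i) If $N$ is a normal subgroup of $G$ with $N\neq 1$, then $NH=G$ and $C_G(N)=1$. (ii) $G$ is subdirectly irreducible and nonsolvable.
   Context: All groups and lattices are finite. For a subgroup $H$ of a group $G$, the interval $[H,G]$ is the set $\{K\mid H\leqslant K\leqslant G\}$ of subgroups, ordered by inclusion; it is a sublattice of the lattice of all subgroups of $G$. A subgroup $H$ is core-free in $G$ if the largest normal subgroup of $G$ contained in $H$ is trivial. $C_G(N)$ is the centralizer of $N$ in $G$. A group is subdirectly irreducible if it has a unique minimal normal subgroup. Parachute lattice: given finite lattices $L_1,\dots,L_n$, each with at least two elements, $\mathscr{P}(L_1,\dots,L_n)$ is the lattice obtained from the disjoint union of $L_1,\dots,L_n$ by identifying all their top elements to a single top element and adjoining one new bottom element $0$ below everything, with no other order relations. Thus the atoms of $\mathscr{P}(L_1,\dots,L_n)$ are exactly the bottom elements of $L_1,\dots,L_n$, each $L_i$ is the interval from its bottom to the top of $\mathscr{P}$, and elements of $L_i$ and $L_j$ ($i\neq j$) other than the common top are incomparable. *)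

theory Defs
  imports "HOL-Algebra.Algebra"
begin

text \<open>Finite lattices are given, as in \<open>HOL-Algebra\<close>, by order structures with an explicit carrier
  satisfying the locale \<^locale>\<open>lattice\<close>.\<close>

datatype ('i, 'a) parachute_elem = PBot | PTop | PElem 'i 'a

text \<open>The quotient map from the disjoint union of the \<open>L i\<close> that identifies all the tops.\<close>

definition parachute_in ::
    "('i \<Rightarrow> ('a, 'b) gorder_scheme) \<Rightarrow> 'i \<Rightarrow> 'a \<Rightarrow> ('i, 'a) parachute_elem" where
  "parachute_in L i x = (if x = \<top>\<^bsub>L i\<^esub> then PTop else PElem i x)"

definition parachute ::
    "nat \<Rightarrow> (nat \<Rightarrow> ('a, 'b) gorder_scheme) \<Rightarrow> (nat, 'a) parachute_elem gorder" where
  "parachute n L =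
     \<lparr>carrier = insert PBot (\<Union>i\<in>{1..n}. parachute_in L i ` carrier (L i)),
      eq = (=),
      le = (\<lambda>p q. p = PBot \<or>
             (\<exists>i\<in>{1..n}. \<exists>x\<in>carrier (L i). \<exists>y\<in>carrier (L i).
                p = parachute_in L i x \<and> q = parachute_in L i y \<and> x \<sqsubseteq>\<^bsub>L i\<^esub> y))\<rparr>"

definition subgroup_interval :: "('a, 'b) monoid_scheme \<Rightarrow> 'a set \<Rightarrow> 'a set gorder" where
  "subgroup_interval G H = \<lparr>carrier = {K. subgroup K G \<and> H \<subseteq> K}, eq = (=), le = (\<subseteq>)\<rparr>"

text \<open>Joins and meets in these structures are determined by the order, so that an isomorphism of
  lattices is an isomorphism of the underlying orders.\<close>

definition lattice_isomorphic ::
    "('a, 'c) gorder_scheme \<Rightarrow> ('b, 'd) gorder_scheme \<Rightarrow> bool" where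
  "lattice_isomorphic A B \<longleftrightarrow>
     (\<exists>f. bij_betw f (carrier A) (carrier B) \<and>
        (\<forall>x\<in>carrier A. \<forall>y\<in>carrier A. x \<sqsubseteq>\<^bsub>A\<^esub> y \<longleftrightarrow> f x \<sqsubseteq>\<^bsub>B\<^esub> f y))"

definition core_free :: "('a, 'b) monoid_scheme \<Rightarrow> 'a set \<Rightarrow> bool" where
  "core_free G H \<longleftrightarrow>
     greatest \<lparr>carrier = {N. N \<lhd> G}, eq = (=), le = (\<subseteq>)\<rparr> {\<one>\<^bsub>G\<^esub>} {N. N \<lhd> G \<and> N \<subseteq> H}"

definition centralizer :: "('a, 'b) monoid_scheme \<Rightarrow> 'a set \<Rightarrow> 'a set" where
  "centralizer G A = {g \<in> carrier G. \<forall>a\<in>A. g \<otimes>\<^bsub>G\<^esub> a = a \<otimes>\<^bsub>G\<^esub> g}"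

definition minimal_normal :: "'a set \<Rightarrow> ('a, 'b) monoid_scheme \<Rightarrow> bool" where
  "minimal_normal N G \<longleftrightarrow>
     N \<lhd> G \<and> N \<noteq> {\<one>\<^bsub>G\<^esub>} \<and> (\<forall>M. M \<lhd> G \<and> M \<subseteq> N \<longrightarrow> M = {\<one>\<^bsub>G\<^esub>} \<or> M = N)"

definition subdirectly_irreducible :: "('a, 'b) monoid_scheme \<Rightarrow> bool" where
  "subdirectly_irreducible G \<longleftrightarrow> (\<exists>!N. minimal_normal N G)"

end

theory Submission
  imports Defs
begin

text \<open>
  The only feature of the parachute that the argument uses is a splitting property
  (\<open>parachute_split\<close>). Let \<open>U\<close> be strictly between \<open>H\<close> and \<open>G\<close>, so that \<open>U\<close> belongs to one panel
  \<open>L\<^sub>i\<close>. Another panel \<open>L\<^sub>j\<close> has more than two elements, and in it there is a proper inclusion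
  \<open>K \<subset> K'\<close> below the top. As distinct panels share only the top, \<open>U\<close> joins with \<open>K\<close> to \<open>G\<close> and
  meets \<open>K'\<close> in \<open>H\<close>.

  Let \<open>N \<noteq> 1\<close> be normal and suppose \<open>NH \<noteq> G\<close>. Since \<open>H\<close> is core-free, \<open>NH\<close> is strictly between
  \<open>H\<close> and \<open>G\<close>; take \<open>K \<subset> K'\<close> for \<open>U = NH\<close>. Then \<open>NK = G\<close>, while \<open>N \<inter> K' \<subseteq> NH \<inter> K' = H \<subseteq> K\<close>,
  so Dedekind's law (\<open>dedekind_subset\<close>) gives \<open>K' = (N \<inter> K')K = K\<close>, a contradiction. Hence
  \<open>NH = G\<close> (\<open>normal_mult_eq_carrier\<close>).

  Suppose also \<open>C = C\<^sub>G(N) \<noteq> 1\<close>. The centralizer \<open>C\<close> is normal too, so \<open>CH = G\<close>. For \<open>K\<close> strictly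
  between \<open>H\<close> and \<open>G\<close> the group \<open>N \<inter> K\<close> is centralized by \<open>C\<close> and normalized by \<open>H\<close>, hence is
  normal in \<open>G\<close>. It lies in \<open>K\<close>, so its product with \<open>H\<close> is not \<open>G\<close>, and therefore \<open>N \<inter> K = 1\<close>.
  Dedekind's law and \<open>NH = G\<close> then give \<open>K = H\<close>, a contradiction
  (\<open>centralizer_normal_trivial\<close>).

  Subdirect irreducibility and nonsolvability follow from the triviality of these centralizers. Two
  distinct minimal normal subgroups would meet trivially and so centralize each other, and the last
  nontrivial term of the derived series of a solvable group is an abelian normal subgroup, contained
  in its own centralizer.
\<close>

section \<open>Centralizers, minimal normal subgroups and Dedekind's law\<close>

context group
begin

text \<open>If \<open>k = n h\<close> with \<open>k \<in> K\<close>, \<open>n \<in> N\<close> and \<open>h \<in> H \<subseteq> K\<close>, then \<open>n = k h\<^sup>-\<^sup>1\<close> lies in \<open>N \<inter> K \<subseteq> H\<close>.\<close>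

lemma dedekind_subset:
  assumes H: "subgroup H G" and K: "subgroup K G" and N: "N \<subseteq> carrier G"
    and HK: "H \<subseteq> K" and KNH: "K \<subseteq> N <#> H" and NK: "N \<inter> K \<subseteq> H"
  shows "K \<subseteq> H"
proof
  fix k assume k: "k \<in> K"
  then obtain n h where n: "n \<in> N" and h: "h \<in> H" and eq: "k = n \<otimes> h"
    using KNH by (auto simp: set_mult_def)
  have G: "n \<in> carrier G" "h \<in> carrier G"
    using n h N H subgroup.subset by blast+
  have "k \<otimes> inv h \<in> K"
    using k h HK K subgroup.m_closed subgroup.m_inv_closed by (metis subsetD)
  moreover have "k \<otimes> inv h = n"
    using G by (simp add: eq m_assoc)
  ultimately have "n \<in> H" using n NK by auto
  then show "k \<in> H" using h H eq by (simp add: subgroup.m_closed)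
qed

lemma subset_set_mult_left:
  assumes "N \<subseteq> carrier G" "subgroup H G"
  shows "N \<subseteq> N <#> H"
  unfolding set_mult_def using assms subgroup.one_closed by fastforce

lemma subset_set_mult_right:
  assumes "subgroup N G" "H \<subseteq> carrier G"
  shows "H \<subseteq> N <#> H"
  unfolding set_mult_def using assms subgroup.one_closed by fastforce

lemma normal_subset_one:
  assumes "N \<lhd> G" "N \<subseteq> {\<one>}"
  shows "N = {\<one>}"
  using assms subgroup.one_closed[OF normal_imp_subgroup[OF assms(1)]] by auto

lemma commuting_conj_inv:
  assumes "x \<in> carrier G" "a \<in> carrier G"
  shows "x \<otimes> a \<otimes> inv x = a \<longleftrightarrow> x \<otimes> a = a \<otimes> x"
  using assms by (metis inv_solve_right m_closed)

lemma centralizer_subset: "centralizer G A \<subseteq> carrier G"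
  unfolding centralizer_def by (rule Collect_restrict)

lemma centralizer_iff_conj:
  assumes "A \<subseteq> carrier G"
  shows "x \<in> centralizer G A \<longleftrightarrow> x \<in> carrier G \<and> (\<forall>a\<in>A. x \<otimes> a \<otimes> inv x = a)"
  using assms commuting_conj_inv unfolding centralizer_def by blast

lemma centralizer_normal:
  assumes "N \<lhd> G"
  shows "centralizer G N \<lhd> G"
proof -
  have N: "N \<subseteq> carrier G" using assms normal_imp_subgroup subgroup.subset by blast
  note c_iff = centralizer_iff_conj[OF N]
  have conj: "inv x \<otimes> a \<otimes> x \<in> N" if "x \<in> carrier G" "a \<in> N" for x a
    using assms that normal.inv_op_closed1 by metis
  have "subgroup (centralizer G N) G"
  proof
    show "centralizer G N \<subseteq> carrier G" by (rule centralizer_subset)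
    show "\<one> \<in> centralizer G N" using N by (auto simp: centralizer_def)
  next
    fix x y assume x: "x \<in> centralizer G N" and y: "y \<in> centralizer G N"
    have G: "x \<in> carrier G" "y \<in> carrier G" using x y centralizer_subset by auto
    have "x \<otimes> y \<otimes> a = a \<otimes> (x \<otimes> y)" if a: "a \<in> N" for a
    proof -
      have aG: "a \<in> carrier G" using a N by blast
      have "x \<otimes> y \<otimes> a = x \<otimes> (a \<otimes> y)"
        using y a G aG by (simp add: m_assoc centralizer_def)
      also have "\<dots> = a \<otimes> x \<otimes> y"
        using x a G aG by (simp add: m_assoc[symmetric] centralizer_def)
      finally show ?thesis using G aG by (simp add: m_assoc)
    qed
    then show "x \<otimes> y \<in> centralizer G N" using G by (simp add: centralizer_def)
  next
    fix x assume x: "x \<in> centralizer G N"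
    have G: "x \<in> carrier G" using x centralizer_subset by auto
    have "inv x \<otimes> a = a \<otimes> inv x" if a: "a \<in> N" for a
    proof -
      have aG: "a \<in> carrier G" using a N by blast
      have "a = x \<otimes> (a \<otimes> inv x)" using x a G aG c_iff by (metis inv_closed m_assoc)
      then show ?thesis using G aG inv_solve_left by (metis inv_closed m_closed)
    qed
    then show "inv x \<in> centralizer G N" using G by (simp add: centralizer_def)
  qed
  moreover have "g \<otimes> c \<otimes> inv g \<in> centralizer G N"
    if g: "g \<in> carrier G" and c: "c \<in> centralizer G N" for g c
  proof -
    have cG: "c \<in> carrier G" using c centralizer_subset by auto
    \<comment> \<open>Conjugating by \<open>g\<close> the fact that \<open>c\<close> commutes with \<open>g\<^sup>-\<^sup>1 a g \<in> N\<close>.\<close>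
    have "(g \<otimes> c \<otimes> inv g) \<otimes> a = a \<otimes> (g \<otimes> c \<otimes> inv g)" if a: "a \<in> N" for a
    proof -
      have aG: "a \<in> carrier G" using a N by blast
      let ?b = "inv g \<otimes> a \<otimes> g"
      have b: "?b \<in> N" using conj g a .
      have cancel: "g \<otimes> (inv g \<otimes> z) = z" if "z \<in> carrier G" for z
        using g that by (simp flip: m_assoc)
      have "(g \<otimes> c \<otimes> inv g) \<otimes> a = g \<otimes> (c \<otimes> ?b) \<otimes> inv g"
        using g cG aG by (simp add: m_assoc)
      also have "\<dots> = g \<otimes> (?b \<otimes> c) \<otimes> inv g"
        using c b by (simp add: centralizer_def)
      also have "\<dots> = a \<otimes> (g \<otimes> c \<otimes> inv g)"
        using cancel g cG aG by (simp add: m_assoc)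
      finally show ?thesis .
    qed
    then show ?thesis using g cG by (simp add: centralizer_def)
  qed
  ultimately show ?thesis by (simp add: normal_inv_iff)
qed

text \<open>The commutator of \<open>m \<in> M\<close> and \<open>n \<in> N\<close> lies in \<open>M \<inter> N\<close>.\<close>

lemma disjoint_normal_subset_centralizer:
  assumes M: "M \<lhd> G" and N: "N \<lhd> G" and MN: "M \<inter> N = {\<one>}"
  shows "M \<subseteq> centralizer G N"
proof
  have sub: "subgroup M G" "subgroup N G" using M N normal_imp_subgroup by blast+
  fix m assume m: "m \<in> M"
  have mG: "m \<in> carrier G" using m sub subgroup.subset by blast
  have "m \<otimes> a = a \<otimes> m" if a: "a \<in> N" for a
  proof -
    have aG: "a \<in> carrier G" using a sub subgroup.subset by blast
    have "(m \<otimes> a \<otimes> inv m) \<otimes> inv a \<in> N"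
      using normal.inv_op_closed2[OF N mG a] a sub subgroup.m_closed subgroup.m_inv_closed by metis
    moreover have "m \<otimes> (a \<otimes> inv m \<otimes> inv a) \<in> M"
      using normal.inv_op_closed2[OF M aG] m sub subgroup.m_closed subgroup.m_inv_closed by metis
    moreover have "(m \<otimes> a \<otimes> inv m) \<otimes> inv a = m \<otimes> (a \<otimes> inv m \<otimes> inv a)"
      using mG aG by (simp add: m_assoc)
    ultimately have "(m \<otimes> a \<otimes> inv m) \<otimes> inv a = \<one>" using MN by auto
    then have "m \<otimes> a \<otimes> inv m = a"
      using inv_equality[of "m \<otimes> a \<otimes> inv m" "inv a"] mG aG by simp
    then show ?thesis using commuting_conj_inv mG aG by blast
  qed
  then show "m \<in> centralizer G N" using mG by (simp add: centralizer_def)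
qed

lemma minimal_normal_exists:
  assumes fin: "finite (carrier G)" and nontriv: "carrier G \<noteq> {\<one>}"
  shows "\<exists>N. minimal_normal N G"
proof -
  define S where "S = {N. N \<lhd> G \<and> N \<noteq> {\<one>}}"
  have "finite S"
    by (rule finite_subset[of _ "Pow (carrier G)"])
      (use fin in \<open>auto simp: S_def dest!: normal_imp_subgroup subgroup.subset\<close>)
  moreover have "carrier G \<in> S" using nontriv normal_self by (simp add: S_def)
  ultimately obtain N where "N \<in> S" and "\<And>M. M \<in> S \<Longrightarrow> M \<subseteq> N \<Longrightarrow> M = N"
    using finite_has_minimal[of S] by blast
  then show ?thesis unfolding minimal_normal_def S_def by blast
qed

lemma derived_trivial_subset_centralizer:
  assumes A: "A \<subseteq> carrier G" and triv: "derived G A = {\<one>}"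
  shows "A \<subseteq> centralizer G A"
proof
  fix x assume x: "x \<in> A"
  have "x \<otimes> a \<otimes> inv x = a" if a: "a \<in> A" for a
  proof -
    have "x \<otimes> a \<otimes> inv x \<otimes> inv a \<in> derived G A"
      unfolding derived_def using x a by (intro generate.incl) auto
    then have "(x \<otimes> a \<otimes> inv x) \<otimes> inv a = \<one>" using triv by simp
    moreover have "x \<in> carrier G" "a \<in> carrier G" using x a A by auto
    ultimately show ?thesis
      using inv_equality[of "x \<otimes> a \<otimes> inv x" "inv a"] by simp
  qed
  then show "x \<in> centralizer G A" using x A centralizer_iff_conj by blast
qed

text \<open>The witness is the last nontrivial term of the derived series.\<close>

lemma solvable_imp_abelian_normal:
  assumes "solvable G" and nontriv: "carrier G \<noteq> {\<one>}"
  shows "\<exists>A. A \<lhd> G \<and> A \<noteq> {\<one>} \<and> A \<subseteq> centralizer G A"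
proof -
  let ?D = "\<lambda>k. (derived G ^^ k) (carrier G)"
  have normal: "?D k \<lhd> G" for k
    by (induction k) (simp_all add: normal_self derived_is_normal)
  define k where "k = (LEAST k. ?D k = {\<one>})"
  have "\<exists>k. ?D k = {\<one>}" using assms(1) solvable_iff_trivial_derived_seq by blast
  then have k: "?D k = {\<one>}" unfolding k_def by (rule LeastI_ex)
  have min: "?D j \<noteq> {\<one>}" if "j < k" for j
    using not_less_Least[of j "\<lambda>k. ?D k = {\<one>}"] that by (simp add: k_def)
  have "k \<noteq> 0" using k nontriv by (cases k) auto
  then obtain j where j: "k = Suc j" using not0_implies_Suc by blast
  have "?D j \<subseteq> carrier G" using normal normal_imp_subgroup subgroup.subset by blast
  moreover have "derived G (?D j) = {\<one>}" using k j by simp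
  ultimately have "?D j \<subseteq> centralizer G (?D j)"
    by (rule derived_trivial_subset_centralizer)
  moreover have "?D j \<noteq> {\<one>}" using min j by blast
  ultimately show ?thesis using normal[of j] by blast
qed

end

section \<open>Core-free subgroups with the splitting property\<close>

text \<open>The property of a parachute interval \<open>[H, G]\<close> on which the argument rests. The group \<open>K'\<close> is
  automatically proper, as its meet with \<open>U\<close> is \<open>H\<close>.\<close>

locale core_free_split_interval = group G for G (structure) +
  fixes H
  assumes subgroup_H: "subgroup H G"
    and core_trivial: "\<lbrakk>N \<lhd> G; N \<subseteq> H\<rbrakk> \<Longrightarrow> N = {\<one>}"
    and intermediate: "\<exists>K. subgroup K G \<and> H \<subset> K \<and> K \<subset> carrier G"
    and split: "\<lbrakk>subgroup U G; H \<subset> U; U \<subset> carrier G\<rbrakk> \<Longrightarrow>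
      \<exists>K K'. subgroup K G \<and> subgroup K' G \<and> H \<subseteq> K \<and> K \<subset> K' \<and> U \<inter> K' \<subseteq> H \<and>
        (\<forall>Y. subgroup Y G \<longrightarrow> U \<subseteq> Y \<longrightarrow> K \<subseteq> Y \<longrightarrow> Y = carrier G)"
begin

text \<open>If \<open>NH\<close> were proper, it would split off a pair \<open>K \<subset> K'\<close> with \<open>NK = G\<close> and \<open>N \<inter> K' \<subseteq> H\<close>, which
  contradicts Dedekind's law.\<close>

lemma normal_mult_eq_carrier:
  assumes N: "N \<lhd> G" and nontriv: "N \<noteq> {\<one>}"
  shows "N <#> H = carrier G"
proof (rule ccontr)
  assume neq: "N <#> H \<noteq> carrier G"
  let ?U = "N <#> H"
  have subN: "subgroup N G" and NG: "N \<subseteq> carrier G"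
    using N normal_imp_subgroup subgroup.subset by blast+
  have HG: "H \<subseteq> carrier G" using subgroup_H subgroup.subset by blast
  have U: "subgroup ?U G" using mult_norm_subgroup N subgroup_H .
  have NX: "N \<subseteq> ?U" and HX: "H \<subseteq> ?U"
    using subset_set_mult_left NG subgroup_H subset_set_mult_right subN HG by blast+
  have "?U \<noteq> H" using NX core_trivial N nontriv by metis
  then have "H \<subset> ?U" using HX by blast
  moreover have "?U \<subset> carrier G" using neq U subgroup.subset by blast
  ultimately obtain K K' where K: "subgroup K G" and K': "subgroup K' G"
    and HK: "H \<subseteq> K" and KK': "K \<subset> K'" and meet: "?U \<inter> K' \<subseteq> H"
    and join: "\<And>Y. subgroup Y G \<Longrightarrow> ?U \<subseteq> Y \<Longrightarrow> K \<subseteq> Y \<Longrightarrow> Y = carrier G"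
    using split[OF U] by metis
  have "N <#> K = carrier G"
  proof (rule join)
    show "subgroup (N <#> K) G" using mult_norm_subgroup N K .
    show "?U \<subseteq> N <#> K" using HK by (rule mono_set_mult[OF subset_refl])
    show "K \<subseteq> N <#> K" using subset_set_mult_right subN K subgroup.subset by blast
  qed
  then have "K' \<subseteq> N <#> K" using K' subgroup.subset by blast
  moreover have "N \<inter> K' \<subseteq> K" using NX meet HK by blast
  ultimately have "K' \<subseteq> K" using dedekind_subset[OF K K' NG] KK' by blast
  then show False using KK' by blast
qed

text \<open>If the centralizer were nontrivial, its product with \<open>H\<close> would be \<open>G\<close>, which makes \<open>N \<inter> K\<close>
  normal in \<open>G\<close> for every \<open>K \<supseteq> H\<close>.\<close>

lemma centralizer_normal_trivial:
  assumes N: "N \<lhd> G" and nontriv: "N \<noteq> {\<one>}"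
  shows "centralizer G N = {\<one>}"
proof (rule ccontr)
  let ?C = "centralizer G N"
  assume "?C \<noteq> {\<one>}"
  then have CH: "?C <#> H = carrier G"
    using normal_mult_eq_carrier centralizer_normal N by blast
  have subN: "subgroup N G" and NG: "N \<subseteq> carrier G"
    using N normal_imp_subgroup subgroup.subset by blast+
  obtain K where K: "subgroup K G" and HK: "H \<subset> K" and KG: "K \<subset> carrier G"
    using intermediate by blast
  have HG: "H \<subseteq> carrier G" using subgroup_H subgroup.subset by blast
  \<comment> \<open>Write \<open>g = c h\<close>: conjugation by \<open>h \<in> K\<close> preserves \<open>N \<inter> K\<close>, and \<open>c\<close> fixes its elements.\<close>
  have "N \<inter> K \<lhd> G"
  proof (rule normal_invI)
    show "subgroup (N \<inter> K) G" using subgroups_Inter_pair subN K .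
    fix g x assume g: "g \<in> carrier G" and x: "x \<in> N \<inter> K"
    have "g \<in> ?C <#> H" using g CH by simp
    then obtain c h where c: "c \<in> ?C" and h: "h \<in> H" and gch: "g = c \<otimes> h"
      unfolding set_mult_def by (elim UN_E singletonE)
    note G = subsetD[OF centralizer_subset c] subsetD[OF HG h] subsetD[OF NG IntD1[OF x]]
    let ?y = "h \<otimes> x \<otimes> inv h"
    have yN: "?y \<in> N" by (rule normal.inv_op_closed2[OF N G(2) IntD1[OF x]])
    have yK: "?y \<in> K"
      using subgroup.m_closed[OF K] subgroup.m_inv_closed[OF K] x h HK by auto
    have "g \<otimes> x \<otimes> inv g = c \<otimes> ?y \<otimes> inv c"
      using G by (simp add: gch m_assoc inv_mult_group)
    also have "\<dots> = ?y"
      using c yN unfolding centralizer_iff_conj[OF NG] by (elim conjE bspec)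
    finally show "g \<otimes> x \<otimes> inv g \<in> N \<inter> K" using yN yK by (simp only: Int_iff)
  qed
  moreover have "(N \<inter> K) <#> H \<noteq> carrier G"
  proof -
    have "(N \<inter> K) <#> H \<subseteq> K"
      using HK K subgroup.m_closed by (fastforce simp: set_mult_def)
    then show ?thesis using KG by blast
  qed
  ultimately have "N \<inter> K = {\<one>}" using normal_mult_eq_carrier by blast
  then have "N \<inter> K \<subseteq> H" using subgroup.one_closed[OF subgroup_H] by simp
  moreover have "K \<subseteq> N <#> H" using normal_mult_eq_carrier[OF N nontriv] KG by blast
  ultimately have "K \<subseteq> H" using dedekind_subset[OF subgroup_H K NG] HK by blast
  then show False using HK by blast
qed

lemma carrier_nontrivial: "carrier G \<noteq> {\<one>}"
proof
  assume eq: "carrier G = {\<one>}"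
  from intermediate obtain K where "H \<subset> K" "K \<subset> carrier G" by (elim exE conjE)
  then have "\<one> \<in> K" "K \<subset> {\<one>}" using subgroup.one_closed[OF subgroup_H] eq by auto
  then show False by auto
qed

lemma subdirectly_irreducible:
  assumes "finite (carrier G)"
  shows "subdirectly_irreducible G"
  unfolding subdirectly_irreducible_def
proof (rule ex_ex1I)
  show "\<exists>N. minimal_normal N G"
    using minimal_normal_exists assms carrier_nontrivial .
next
  fix M N assume M: "minimal_normal M G" and N: "minimal_normal N G"
  show "M = N"
  proof (rule ccontr)
    assume neq: "M \<noteq> N"
    have nM: "M \<lhd> G" "M \<noteq> {\<one>}" and nN: "N \<lhd> G" "N \<noteq> {\<one>}"
      using M N by (simp_all add: minimal_normal_def)
    have "M \<inter> N \<lhd> G" using normal_subgroup_intersect nM nN by blast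
    then have "M \<inter> N = {\<one>} \<or> M \<inter> N = M" "M \<inter> N = {\<one>} \<or> M \<inter> N = N"
      using M N by (simp_all add: minimal_normal_def)
    then have "M \<inter> N = {\<one>}" using neq by auto
    then have "M \<subseteq> centralizer G N"
      by (rule disjoint_normal_subset_centralizer[OF nM(1) nN(1)])
    then have "M \<subseteq> {\<one>}" unfolding centralizer_normal_trivial[OF nN] .
    then have "M = {\<one>}" by (rule normal_subset_one[OF nM(1)])
    with nM(2) show False by contradiction
  qed
qed

lemma not_solvable: "\<not> solvable G"
proof
  assume "solvable G"
  from solvable_imp_abelian_normal[OF this carrier_nontrivial]
  obtain A where A: "A \<lhd> G" "A \<noteq> {\<one>}" "A \<subseteq> centralizer G A" by (elim exE conjE)
  have "A \<subseteq> {\<one>}" using A(3) unfolding centralizer_normal_trivial[OF A(1,2)] .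
  then have "A = {\<one>}" by (rule normal_subset_one[OF A(1)])
  with A(2) show False by contradiction
qed

end

section \<open>The splitting property of parachutes\<close>

lemma (in lattice) finite_greatest_top:
  assumes "finite (carrier L)" "carrier L \<noteq> {}"
  shows "greatest L \<top> (carrier L)"
proof -
  have "least L (\<Squnion>(carrier L)) (Upper L (carrier L))"
    using finite_sup_least assms by blast
  then have "greatest L (\<Squnion>(carrier L)) (carrier L)"
    by (auto simp: least_def greatest_def Upper_def)
  then show ?thesis unfolding top_def by (rule someI)
qed

lemma (in lattice) finite_least_bottom:
  assumes "finite (carrier L)" "carrier L \<noteq> {}"
  shows "least L \<bottom> (carrier L)"
proof -
  have "greatest L (\<Sqinter>(carrier L)) (Lower L (carrier L))"
    using finite_inf_greatest assms by blast
  then have "least L (\<Sqinter>(carrier L)) (carrier L)"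
    by (auto simp: least_def greatest_def Lower_def)
  then show ?thesis unfolding bottom_def by (rule someI)
qed

locale parachute_panels =
  fixes n :: nat and L :: "nat \<Rightarrow> ('a, 'b) gorder_scheme"
  assumes lattice_L: "i \<in> {1..n} \<Longrightarrow> lattice (L i)"
    and finite_L: "i \<in> {1..n} \<Longrightarrow> finite (carrier (L i))"
    and card_L: "i \<in> {1..n} \<Longrightarrow> card (carrier (L i)) \<ge> 2"
    and large_L: "card {i \<in> {1..n}. card (carrier (L i)) > 2} \<ge> 2"
begin

abbreviation "P \<equiv> parachute n L"

lemma top_L: "i \<in> {1..n} \<Longrightarrow> greatest (L i) \<top>\<^bsub>L i\<^esub> (carrier (L i))"
  using lattice.finite_greatest_top[OF lattice_L finite_L] card_L by fastforce

lemma bottom_L: "i \<in> {1..n} \<Longrightarrow> least (L i) \<bottom>\<^bsub>L i\<^esub> (carrier (L i))"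
  using lattice.finite_least_bottom[OF lattice_L finite_L] card_L by fastforce

lemma top_maximal:
  assumes i: "i \<in> {1..n}" and x: "x \<in> carrier (L i)" and le: "\<top>\<^bsub>L i\<^esub> \<sqsubseteq>\<^bsub>L i\<^esub> x"
  shows "x = \<top>\<^bsub>L i\<^esub>"
proof -
  interpret lattice "L i" using lattice_L i .
  show ?thesis using le_antisym le x top_L[OF i] by (meson greatest_closed greatest_le)
qed

lemma large_panel_avoiding: "\<exists>j \<in> {1..n}. j \<noteq> i \<and> card (carrier (L j)) > 2"
proof (rule ccontr)
  assume "\<not> ?thesis"
  then have "{j \<in> {1..n}. card (carrier (L j)) > 2} \<subseteq> {i}" by auto
  from card_mono[OF _ this] show False using large_L by simp
qed

lemma middle_element:
  assumes "card (carrier (L j)) > 2"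
  obtains y where "y \<in> carrier (L j)" "y \<noteq> \<top>\<^bsub>L j\<^esub>" "y \<noteq> \<bottom>\<^bsub>L j\<^esub>"
proof -
  have "\<not> carrier (L j) \<subseteq> {\<top>\<^bsub>L j\<^esub>, \<bottom>\<^bsub>L j\<^esub>}"
  proof
    assume "carrier (L j) \<subseteq> {\<top>\<^bsub>L j\<^esub>, \<bottom>\<^bsub>L j\<^esub>}"
    then have "card (carrier (L j)) \<le> card {\<top>\<^bsub>L j\<^esub>, \<bottom>\<^bsub>L j\<^esub>}" by (intro card_mono) auto
    also have "\<dots> \<le> 2" by (simp add: card_insert_if)
    finally show False using assms by simp
  qed
  then show thesis using that by blast
qed

lemma bottom_neq_top:
  assumes i: "i \<in> {1..n}"
  shows "\<bottom>\<^bsub>L i\<^esub> \<noteq> \<top>\<^bsub>L i\<^esub>"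
proof
  assume eq: "\<bottom>\<^bsub>L i\<^esub> = \<top>\<^bsub>L i\<^esub>"
  have "x = \<top>\<^bsub>L i\<^esub>" if "x \<in> carrier (L i)" for x
    using top_maximal[OF i that] bottom_L[OF i] that eq by (metis least_le)
  then have "card (carrier (L i)) \<le> card {\<top>\<^bsub>L i\<^esub>}" by (intro card_mono) auto
  then show False using card_L[OF i] by simp
qed

lemma PBot_in: "PBot \<in> carrier P"
  by (simp add: parachute_def)

lemma parachute_in_in:
  assumes "i \<in> {1..n}" "x \<in> carrier (L i)"
  shows "parachute_in L i x \<in> carrier P"
  unfolding parachute_def using assms by auto

lemma parachute_in_le:
  assumes "i \<in> {1..n}" "x \<in> carrier (L i)" "y \<in> carrier (L i)" "x \<sqsubseteq>\<^bsub>L i\<^esub> y"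
  shows "parachute_in L i x \<sqsubseteq>\<^bsub>P\<^esub> parachute_in L i y"
  unfolding parachute_def using assms by auto

lemma top_in_L: "i \<in> {1..n} \<Longrightarrow> \<top>\<^bsub>L i\<^esub> \<in> carrier (L i)"
  using top_L unfolding greatest_def by blast

lemma le_top_L: "\<lbrakk>i \<in> {1..n}; x \<in> carrier (L i)\<rbrakk> \<Longrightarrow> x \<sqsubseteq>\<^bsub>L i\<^esub> \<top>\<^bsub>L i\<^esub>"
  using top_L unfolding greatest_def by blast

lemma parachute_in_top: "parachute_in L i \<top>\<^bsub>L i\<^esub> = PTop"
  by (simp add: parachute_in_def)

lemma parachute_in_PElem: "x \<noteq> \<top>\<^bsub>L i\<^esub> \<Longrightarrow> parachute_in L i x = PElem i x"
  by (simp add: parachute_in_def)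

lemma PElem_in:
  assumes "i \<in> {1..n}" "x \<in> carrier (L i)" "x \<noteq> \<top>\<^bsub>L i\<^esub>"
  shows "PElem i x \<in> carrier P"
  using parachute_in_in[OF assms(1,2)] assms(3) by (simp add: parachute_in_PElem)

lemma PTop_in: "PTop \<in> carrier P"
proof -
  obtain i where i: "i \<in> {1..n}" using large_panel_avoiding[of 0] by blast
  then show ?thesis using parachute_in_in[OF i top_in_L[OF i]] by (simp only: parachute_in_top)
qed

lemma carrier_cases:
  assumes "p \<in> carrier P"
  obtains "p = PBot" | "p = PTop"
  | i x where "p = PElem i x" "i \<in> {1..n}" "x \<in> carrier (L i)" "x \<noteq> \<top>\<^bsub>L i\<^esub>"
proof (cases "p = PBot")
  case False
  then obtain i x where "i \<in> {1..n}" "x \<in> carrier (L i)" "p = parachute_in L i x"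
    using assms unfolding parachute_def by auto
  then show thesis using that(2,3) by (cases "x = \<top>\<^bsub>L i\<^esub>") (simp_all add: parachute_in_def)
qed (rule that(1))

lemma PBot_le: "PBot \<sqsubseteq>\<^bsub>P\<^esub> p"
  by (simp add: parachute_def)

lemma le_PTop:
  assumes "p \<in> carrier P"
  shows "p \<sqsubseteq>\<^bsub>P\<^esub> PTop"
proof (cases "p = PBot")
  case False
  then obtain i x where p: "i \<in> {1..n}" "x \<in> carrier (L i)" "p = parachute_in L i x"
    using assms unfolding parachute_def by auto
  then show ?thesis
    using parachute_in_le[OF p(1,2) top_in_L le_top_L] by (simp only: parachute_in_top)
qed (simp add: PBot_le)

lemma PElem_le_PElem:
  assumes "i \<in> {1..n}" "x \<in> carrier (L i)" "y \<in> carrier (L i)"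
    "x \<noteq> \<top>\<^bsub>L i\<^esub>" "y \<noteq> \<top>\<^bsub>L i\<^esub>" "x \<sqsubseteq>\<^bsub>L i\<^esub> y"
  shows "PElem i x \<sqsubseteq>\<^bsub>P\<^esub> PElem i y"
  using parachute_in_le[OF assms(1-3,6)]
  unfolding parachute_in_PElem[OF assms(4)] parachute_in_PElem[OF assms(5)] .

lemma above_PElem:
  assumes "PElem i x \<sqsubseteq>\<^bsub>P\<^esub> r"
  shows "r = PTop \<or> (\<exists>y. r = PElem i y)"
  using assms by (auto simp: parachute_def parachute_in_def split: if_splits)

text \<open>The top lies below no \<open>PElem i x\<close>, as that would put the top of \<open>L i\<close> below \<open>x\<close>.\<close>

lemma below_PElem:
  assumes "r \<sqsubseteq>\<^bsub>P\<^esub> PElem i x"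
  shows "r = PBot \<or> (\<exists>y. r = PElem i y)"
  using assms
  by (auto simp: parachute_def parachute_in_def simp del: atLeastAtMost_iff One_nat_def
      dest: top_maximal split: if_splits)

text \<open>For \<open>p\<close> in panel \<open>i\<close>, the pair consists of the bottom and a middle element of another panel.\<close>

lemma parachute_split:
  assumes p: "p \<in> carrier P" "p \<noteq> PBot" "p \<noteq> PTop"
  shows "\<exists>q\<in>carrier P. \<exists>q'\<in>carrier P. q \<sqsubseteq>\<^bsub>P\<^esub> q' \<and> q \<noteq> q' \<and>
    (\<forall>r\<in>carrier P. r \<sqsubseteq>\<^bsub>P\<^esub> p \<longrightarrow> r \<sqsubseteq>\<^bsub>P\<^esub> q' \<longrightarrow> r = PBot) \<and>
    (\<forall>r\<in>carrier P. p \<sqsubseteq>\<^bsub>P\<^esub> r \<longrightarrow> q \<sqsubseteq>\<^bsub>P\<^esub> r \<longrightarrow> r = PTop)"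
proof -
  obtain i x where px: "p = PElem i x" using p by (auto elim: carrier_cases)
  obtain j where j: "j \<in> {1..n}" "j \<noteq> i" "card (carrier (L j)) > 2"
    using large_panel_avoiding[of i] by blast
  obtain y where y: "y \<in> carrier (L j)" "y \<noteq> \<top>\<^bsub>L j\<^esub>" "y \<noteq> \<bottom>\<^bsub>L j\<^esub>"
    using middle_element j(3) .
  have b: "\<bottom>\<^bsub>L j\<^esub> \<in> carrier (L j)" "\<bottom>\<^bsub>L j\<^esub> \<sqsubseteq>\<^bsub>L j\<^esub> y" "\<bottom>\<^bsub>L j\<^esub> \<noteq> \<top>\<^bsub>L j\<^esub>"
    using bottom_L[OF j(1)] bottom_neq_top[OF j(1)] y by (auto simp: least_def)
  show ?thesis
  proof (rule bexI[of _ "PElem j \<bottom>\<^bsub>L j\<^esub>"], rule bexI[of _ "PElem j y"],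
      intro conjI ballI impI)
    show "PElem j \<bottom>\<^bsub>L j\<^esub> \<in> carrier P" "PElem j y \<in> carrier P"
      using PElem_in j b y by blast+
    show "PElem j \<bottom>\<^bsub>L j\<^esub> \<sqsubseteq>\<^bsub>P\<^esub> PElem j y" using PElem_le_PElem j b y by blast
    show "PElem j \<bottom>\<^bsub>L j\<^esub> \<noteq> PElem j y" using y by simp
  next
    fix r assume "r \<sqsubseteq>\<^bsub>P\<^esub> p" "r \<sqsubseteq>\<^bsub>P\<^esub> PElem j y"
    then show "r = PBot" using below_PElem px j(2) by blast
  next
    fix r assume "p \<sqsubseteq>\<^bsub>P\<^esub> r" "PElem j \<bottom>\<^bsub>L j\<^esub> \<sqsubseteq>\<^bsub>P\<^esub> r"
    then show "r = PTop" using above_PElem px j(2) by blast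
  qed
qed

lemma parachute_intermediate: "\<exists>p\<in>carrier P. p \<noteq> PBot \<and> p \<noteq> PTop"
proof -
  obtain i where i: "i \<in> {1..n}" using large_panel_avoiding[of 0] by blast
  have "PElem i \<bottom>\<^bsub>L i\<^esub> \<in> carrier P"
    using PElem_in[OF i] bottom_L[OF i] bottom_neq_top[OF i] by (simp add: least_def)
  then show ?thesis by blast
qed

text \<open>An order isomorphism maps \<open>PBot\<close> to \<open>H\<close> and \<open>PTop\<close> to \<open>G\<close>, and so carries the splitting
  property over.\<close>

lemma core_free_split_interval:
  fixes G :: "('g, 'm) monoid_scheme"
  assumes "group G" and H: "subgroup H G" and core: "core_free G H"
    and iso: "lattice_isomorphic P (subgroup_interval G H)"
  shows "core_free_split_interval G H"
proof -
  interpret group G by fact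
  let ?I = "{K. subgroup K G \<and> H \<subseteq> K}"
  obtain f where bij: "bij_betw f (carrier P) ?I"
    and mono: "\<And>p q. p \<in> carrier P \<Longrightarrow> q \<in> carrier P \<Longrightarrow> p \<sqsubseteq>\<^bsub>P\<^esub> q \<longleftrightarrow> f p \<subseteq> f q"
    using iso by (auto simp: lattice_isomorphic_def subgroup_interval_def)
  have f_in: "subgroup (f p) G" "H \<subseteq> f p" if "p \<in> carrier P" for p
    using bij_betwE[OF bij] that by auto
  have f_inj: "f p = f q \<longleftrightarrow> p = q" if "p \<in> carrier P" "q \<in> carrier P" for p q
    using bij that by (meson bij_betw_imp_inj_on inj_on_eq_iff)
  have f_surj: "\<exists>p\<in>carrier P. f p = K" if "subgroup K G" "H \<subseteq> K" for K
    using bij that by (metis (mono_tags, lifting) bij_betw_iff_bijections mem_Collect_eq)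
  have HG: "H \<subseteq> carrier G" using H subgroup.subset by blast
  have bot: "f PBot = H"
  proof -
    obtain p where "p \<in> carrier P" "f p = H" using f_surj H by blast
    then show ?thesis using f_in(2)[OF PBot_in] mono[OF PBot_in] PBot_le by blast
  qed
  have top: "f PTop = carrier G"
  proof -
    obtain p where "p \<in> carrier P" "f p = carrier G" using f_surj subgroup_self HG by blast
    then show ?thesis
      using subgroup.subset[OF f_in(1)[OF PTop_in]] mono[OF _ PTop_in] le_PTop by blast
  qed
  show ?thesis
  proof (intro core_free_split_interval.intro core_free_split_interval_axioms.intro)
    show "group G" "subgroup H G" by fact+
  next
    fix N assume "N \<lhd> G" "N \<subseteq> H"
    then have "N \<subseteq> {\<one>\<^bsub>G\<^esub>}" using core by (auto simp: core_free_def greatest_def)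
    then show "N = {\<one>\<^bsub>G\<^esub>}" using normal_subset_one[OF \<open>N \<lhd> G\<close>] by blast
  next
    obtain p where p: "p \<in> carrier P" "p \<noteq> PBot" "p \<noteq> PTop"
      using parachute_intermediate by blast
    have "f p \<noteq> H" "f p \<noteq> carrier G"
      using f_inj p PBot_in PTop_in bot top by metis+
    then show "\<exists>K. subgroup K G \<and> H \<subset> K \<and> K \<subset> carrier G"
      using f_in[OF p(1)] subgroup.subset by blast
  next
    fix U assume U: "subgroup U G" "H \<subset> U" "U \<subset> carrier G"
    obtain p where p: "p \<in> carrier P" "f p = U" using f_surj U by blast
    have "f PBot \<noteq> U" "f PTop \<noteq> U" unfolding bot top using U(2,3) by auto
    then have "p \<noteq> PBot" "p \<noteq> PTop" unfolding p(2)[symmetric] by auto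
    from parachute_split[OF p(1) this] obtain q q' where q: "q \<in> carrier P" "q' \<in> carrier P" "q \<sqsubseteq>\<^bsub>P\<^esub> q'" "q \<noteq> q'"
      and meet: "\<And>r. r \<in> carrier P \<Longrightarrow> r \<sqsubseteq>\<^bsub>P\<^esub> p \<Longrightarrow> r \<sqsubseteq>\<^bsub>P\<^esub> q' \<Longrightarrow> r = PBot"
      and join: "\<And>r. r \<in> carrier P \<Longrightarrow> p \<sqsubseteq>\<^bsub>P\<^esub> r \<Longrightarrow> q \<sqsubseteq>\<^bsub>P\<^esub> r \<Longrightarrow> r = PTop"
      by blast
    have "f q \<subset> f q'" using q(3,4) mono[OF q(1,2)] f_inj[OF q(1,2)] by auto
    moreover have "U \<inter> f q' \<subseteq> H"
    proof -
      obtain r where r: "r \<in> carrier P" "f r = U \<inter> f q'"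
        using f_surj[OF subgroups_Inter_pair[OF U(1) f_in(1)[OF q(2)]]] U(2) f_in(2)[OF q(2)] by auto
      have "r = PBot"
        using meet[OF r(1)] mono[OF r(1) p(1)] mono[OF r(1) q(2)] r(2) p(2) by simp
      then show ?thesis using r(2) bot by simp
    qed
    moreover have "Y = carrier G" if Y: "subgroup Y G" "U \<subseteq> Y" "f q \<subseteq> Y" for Y
    proof -
      obtain r where r: "r \<in> carrier P" "f r = Y" using f_surj[OF Y(1)] Y(2) U(2) by auto
      have "r = PTop"
        using join[OF r(1)] mono[OF p(1) r(1)] mono[OF q(1) r(1)] r(2) p(2) Y(2,3) by simp
      then show ?thesis using r(2) top by simp
    qed
    ultimately show "\<exists>K K'. subgroup K G \<and> subgroup K' G \<and> H \<subseteq> K \<and> K \<subset> K' \<and> U \<inter> K' \<subseteq> H \<and>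
        (\<forall>Y. subgroup Y G \<longrightarrow> U \<subseteq> Y \<longrightarrow> K \<subseteq> Y \<longrightarrow> Y = carrier G)"
      using f_in[OF q(1)] f_in(1)[OF q(2)] by blast
  qed
qed

end

theorem lemma3p7:
  fixes n :: nat
    and L :: "nat \<Rightarrow> ('a, 'b) gorder_scheme"
    and G :: "('g, 'm) monoid_scheme"
    and H :: "'g set"
  assumes "n \<ge> 2"
    and "\<And>i. i \<in> {1..n} \<Longrightarrow> lattice (L i)"
    and "\<And>i. i \<in> {1..n} \<Longrightarrow> finite (carrier (L i))"
    and "\<And>i. i \<in> {1..n} \<Longrightarrow> card (carrier (L i)) \<ge> 2"
    and "card {i \<in> {1..n}. card (carrier (L i)) > 2} \<ge> 2"
    and "group G"
    and "finite (carrier G)"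
    and "subgroup H G"
    and "core_free G H"
    and "lattice_isomorphic (parachute n L) (subgroup_interval G H)"
  shows "(\<forall>N. N \<lhd> G \<and> N \<noteq> {\<one>\<^bsub>G\<^esub>} \<longrightarrow>
            N <#>\<^bsub>G\<^esub> H = carrier G \<and> centralizer G N = {\<one>\<^bsub>G\<^esub>})
       \<and> (subdirectly_irreducible G \<and> \<not> solvable G)"
proof -
  interpret panels: parachute_panels n L
    using assms(2-5) by (rule parachute_panels.intro)
  interpret core_free_split_interval G H
    using panels.core_free_split_interval assms(6,8-10) .
  show ?thesis
  proof (intro conjI allI impI; (elim conjE)?)
    fix N assume N: "N \<lhd> G" "N \<noteq> {\<one>\<^bsub>G\<^esub>}"
    show "N <#>\<^bsub>G\<^esub> H = carrier G" using N by (rule normal_mult_eq_carrier)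
    show "centralizer G N = {\<one>\<^bsub>G\<^esub>}" using N by (rule centralizer_normal_trivial)
  next
    show "subdirectly_irreducible G" using assms(7) by (rule subdirectly_irreducible)
    show "\<not> solvable G" by (rule not_solvable)
  qed
qed

end
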